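(* Let $F:\Omega\times I\to\Omega\times I$, $F(\omega,x)=(\tau(\omega),f_{\omega_0}(x))$, be a one-step skew product over the Bernoulli shift $\tau$ on $(\Omega,\mathscr F,\mathbb P)=(\mathcal A^{\mathbb N},\mathcal F^{\mathbb N},p^{\mathbb N})$. Assume: (a) for every $x\in(0,1)$, the sequence $\{X^x_n\}_{n\ge1}$ of random variables $X^x_n(\omega)=f^n_\omega(x)$ has trivial tail $\sigma$-algebra, i.e. $\mathbb P(A)\in\{0,1\}$ for every $A\in\mathcal T(\{X^x_n\}_{n\ge1})$; (b) for every $\omega\in\Omega$, $f_\omega$ restricts to a map $f_\omega:(0,1)\to(0,1)$ which is measurable and monotonically increasing ($x\le y$ implies $f_\omega(x)\le f_\omega(y)$); (c) for every $x\in(0,1)$ there exist $\alpha,\beta\in\Omega$ such that $f_\alpha(x)<x<f_\beta(x)$; (d) $F$ satisfies the pointwise-fiber fluctuation law with constants $\gamma_0<\gamma_1$. Then for every $x\in(0,1)$, $$\liminf_{n\to\infty}\frac1n\sum_{j=0}^{n-1}f^j_\omega(x)\le\gamma_0<\gamma_1\le\limsup_{n\to\infty}\frac1n\sum_{j=0}^{n-1}f^j_\omega(x)\qquad\text{for }\mathbb P\text{-a.e. }\omega\in\Omega.$$ In particular, $F$ exhibits historical behavior for $(\mathbb P\times\mathrm{Leb})$-almost every point.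
   Context: $I=[0,1]$ with Lebesgue measure $\mathrm{Leb}$. $\mathcal A$ is an at most countable alphabet, $\mathcal F$ its discrete $\sigma$-algebra, $p$ a probability measure on $\mathcal A$ with $p(a)>0$ for every $a\in\mathcal A$; $(\Omega,\mathscr F,\mathbb P)=(\mathcal A^{\mathbb N},\mathcal F^{\mathbb N},p^{\mathbb N})$ and $\tau:\Omega\to\Omega$ is the (one-sided) shift. The fiber maps $f_a:I\to I$, $a\in\mathcal A$, are measurable; for $\omega=(\omega_i)_{i\ge0}$ write $f_\omega=f_{\omega_0}$, $f^0_\omega=\mathrm{id}$ and $f^n_\omega=f_{\omega_{n-1}}\circ\dots\circ f_{\omega_0}$ for $n\ge1$. Tail $\sigma$-algebra: $\mathcal T(\{X_n\}_{n\ge1})=\bigcap_{m\ge1}\sigma(X_m,X_{m+1},\dots)$. Pointwise-fiber fluctuation law with constants $\gamma_0,\gamma_1\in(0,1)$: there are points $x_0,x_1\in(0,1)$ such that $$\liminf_{n\to\infty}\mathbb P\Big(\frac1n\sum_{j=0}^{n-1}\mathbf 1_{I_i(\gamma_i)}(f^j_\omega(x_i))\le\alpha\Big)<1\quad\text{for every }\alpha\in(0,1)\text{ and }i=0,1,$$ where $I_0(\gamma)=[0,\gamma]$ and $I_1(\gamma)=[\gamma,1]$. Historical behavior for $(\mathbb P\times\mathrm{Leb})$-a.e. point: for $(\mathbb P\times\mathrm{Leb})$-a.e. $(\omega,x)$ there is a continuous function $\varphi:I\to\mathbb R$ such that $\lim_{n\to\infty}\frac1n\sum_{j=0}^{n-1}\varphi(f^j_\omega(x))$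 does not exist. *)

theory Defs
  imports "HOL-Probability.Probability"
begin

text \<open>The alphabet is a type \<open>'a\<close>, so the sequence space is all of \<open>nat \<Rightarrow> 'a\<close>; a measure
  on the discrete \<open>\<sigma>\<close>-algebra of a countable alphabet is a \<open>pmf\<close>.\<close>

definition bernoulli_measure :: "'a pmf \<Rightarrow> (nat \<Rightarrow> 'a) measure" where
  "bernoulli_measure p = (\<Pi>\<^sub>M i\<in>UNIV. measure_pmf p)"

definition left_shift :: "(nat \<Rightarrow> 'a) \<Rightarrow> (nat \<Rightarrow> 'a)" where
  "left_shift \<omega> = (\<lambda>n. \<omega> (Suc n))"

text \<open>Fiber maps are total functions on \<open>real\<close>, of which only the values on \<open>{0..1}\<close> matter.\<close>

definition skew_product ::
    "('a \<Rightarrow> real \<Rightarrow> real) \<Rightarrow> (nat \<Rightarrow> 'a) \<times> real \<Rightarrow> (nat \<Rightarrow> 'a) \<times> real" where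
  "skew_product f = (\<lambda>(\<omega>, x). (left_shift \<omega>, f (\<omega> 0) x))"

primrec fiber_iter :: "('a \<Rightarrow> real \<Rightarrow> real) \<Rightarrow> (nat \<Rightarrow> 'a) \<Rightarrow> nat \<Rightarrow> real \<Rightarrow> real" where
  "fiber_iter f \<omega> 0 x = x"
| "fiber_iter f \<omega> (Suc n) x = f (\<omega> n) (fiber_iter f \<omega> n x)"

lemma skew_product_funpow:
  "(skew_product f ^^ n) (\<omega>, x) = ((left_shift ^^ n) \<omega>, fiber_iter f \<omega> n x)"
proof -
  have shift_n: "(left_shift ^^ n) \<omega> k = \<omega> (n + k)" for n k
    by (induction n arbitrary: k) (simp_all add: left_shift_def)
  show ?thesis
    by (induction n) (simp_all add: skew_product_def, simp add: shift_n)
qed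

text \<open>The shift of the index makes the sequence start with \<open>X 1\<close>.\<close>

definition tail_sigma_algebra :: "'b measure \<Rightarrow> (nat \<Rightarrow> 'b \<Rightarrow> real) \<Rightarrow> 'b set set" where
  "tail_sigma_algebra M X =
     prob_space.tail_events M (\<lambda>n. sets (vimage_algebra (space M) (X (Suc n)) borel))"

text \<open>The averages below divide by \<open>0\<close> at \<open>n = 0\<close>; this affects neither limits nor
  \<open>liminf\<close> and \<open>limsup\<close>. The latter are taken in \<open>ereal\<close>.\<close>

definition birkhoff_average ::
    "('a \<Rightarrow> real \<Rightarrow> real) \<Rightarrow> (real \<Rightarrow> real) \<Rightarrow> (nat \<Rightarrow> 'a) \<Rightarrow> real \<Rightarrow> nat \<Rightarrow> real" where
  "birkhoff_average f \<phi> \<omega> x n = (1 / real n) * (\<Sum>j<n. \<phi> (fiber_iter f \<omega> j x))"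

definition pointwise_fiber_fluctuation_law ::
    "'a pmf \<Rightarrow> ('a \<Rightarrow> real \<Rightarrow> real) \<Rightarrow> real \<Rightarrow> real \<Rightarrow> bool" where
  "pointwise_fiber_fluctuation_law p f \<gamma>0 \<gamma>1 \<longleftrightarrow>
     (\<exists>x0\<in>{0<..<1}. \<exists>x1\<in>{0<..<1}. \<forall>\<alpha>\<in>{0<..<1}.
        liminf (\<lambda>n. ereal (measure (bernoulli_measure p)
          {\<omega> \<in> space (bernoulli_measure p).
             birkhoff_average f (indicator {0..\<gamma>0}) \<omega> x0 n \<le> \<alpha>})) < 1 \<and>
        liminf (\<lambda>n. ereal (measure (bernoulli_measure p)
          {\<omega> \<in> space (bernoulli_measure p).
             birkhoff_average f (indicator {\<gamma>1..1}) \<omega> x1 n \<le> \<alpha>})) < 1)"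

definition historical_behavior_ae :: "'a pmf \<Rightarrow> ('a \<Rightarrow> real \<Rightarrow> real) \<Rightarrow> bool" where
  "historical_behavior_ae p f \<longleftrightarrow>
     (AE (\<omega>, x) in bernoulli_measure p \<Otimes>\<^sub>M restrict_space lborel {0..1}.
        \<exists>\<phi>. continuous_on {0..1} \<phi> \<and> \<not> convergent (birkhoff_average f \<phi> \<omega> x))"

end

theory Submission
  imports Defs
begin

text \<open>
  Fix a level \<open>c\<close> and a bounded monotone or antitone observable \<open>\<phi>\<close>, and let \<open>G\<close> be the set of
  starting points \<open>x\<close> in \<open>(0,1)\<close> whose Birkhoff averages of \<open>\<phi>\<close> have lower limit at most \<open>c\<close> for
  almost every \<open>\<omega>\<close>. The bound on the lower limits of the averages of \<open>y\<close> is the case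
  \<open>\<phi>(y) = y\<close>, \<open>c = \<gamma>0\<close>; the bound on the upper limits is the case \<open>\<phi>(y) = -y\<close>, \<open>c = -\<gamma>1\<close>.

  The event that the lower limit is at most \<open>c\<close> does not depend on finitely many terms of the
  orbit, so it is a tail event (\<open>low_average_event_tail\<close>) and has probability 0 or 1. Three
  observations then give \<open>G = (0,1)\<close>.

  \<^item> Replacing the first letter by its value \<open>a\<close> moves the starting point from \<open>x\<close> to \<open>f a x\<close>. All
    letters have positive mass, so probability one at \<open>x\<close> forces probability one at every \<open>f a x\<close>,
    and probability zero at \<open>x\<close> forces probability zero at every \<open>f a x\<close>. Hence both \<open>G\<close> and its
    complement in \<open>(0,1)\<close> are invariant under all fiber maps.
  \<^item> Since the fiber maps preserve order, \<open>G\<close> is an initial segment of \<open>(0,1)\<close> if \<open>\<phi>\<close> is monotone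
    and a final one if \<open>\<phi>\<close> is antitone. A proper nonempty segment has an endpoint in \<open>(0,1)\<close>, and
    this endpoint is moved strictly up by one fiber map and strictly down by another. One of the
    two crosses between \<open>G\<close> and its complement, which contradicts invariance
    (\<open>invariant_lower_set_full\<close>).
  \<^item> The fluctuation law provides a point of \<open>G\<close>. If the orbit of the reference point spends more
    than a fraction \<open>\<alpha>\<close> of the time up to \<open>n\<close> near the relevant endpoint, then the average of
    \<open>\<phi>\<close> at time \<open>n\<close> is at most a value that tends to \<open>c\<close> as \<open>\<alpha>\<close> tends to 1. The law says that the
    probability of such long visits does not tend to 0, so with positive probability they occur
    for infinitely many \<open>n\<close> (\<open>not_AE_not_low_average\<close>), and by triviality of the tail almost surely.

  This is carried out for each \<open>\<alpha> < 1\<close> separately, and \<open>\<alpha>\<close> is sent to 1 along a sequence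
  (\<open>liminf_average_le\<close>). Historical behavior follows by Fubini, with the identity as the
  observable whose averages diverge.
\<close>

section \<open>Limits of probabilities and of averages\<close>

text \<open>
  The events that \<open>A k\<close> holds for all \<open>k \<ge> n\<close> increase with \<open>n\<close> to an event of probability one, and
  the \<open>n\<close>th of them lies in \<open>A n\<close>. The contrapositive turns the fluctuation law into
  a statement about what happens infinitely often.
\<close>

lemma (in prob_space) liminf_prob_ge_1:
  assumes A: "\<And>n::nat. A n \<in> events"
    and ev: "AE \<omega> in M. eventually (\<lambda>n. \<omega> \<in> A n) sequentially"
  shows "1 \<le> liminf (\<lambda>n. ereal (prob (A n)))"
proof -
  define B where "B n = (\<Inter>k\<in>{n..}. A k)" for n
  have B_events: "B n \<in> events" for n
    unfolding B_def by (intro sets.countable_INT) (auto simp: A)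
  have "(\<Union>n. B n) \<in> events" using B_events by auto
  moreover have "AE \<omega> in M. \<omega> \<in> (\<Union>n. B n)"
    using ev by eventually_elim (auto simp: B_def eventually_sequentially)
  ultimately have "prob (\<Union>n. B n) = 1" by (simp add: prob_eq_1)
  moreover have "incseq B" unfolding B_def incseq_def by fastforce
  ultimately have "(\<lambda>n. prob (B n)) \<longlonglongrightarrow> 1"
    using finite_Lim_measure_incseq[of B] B_events by auto
  then have "liminf (\<lambda>n. ereal (prob (B n))) = ereal 1"
    by (intro lim_imp_Liminf) auto
  moreover have "liminf (\<lambda>n. ereal (prob (B n))) \<le> liminf (\<lambda>n. ereal (prob (A n)))"
  proof (intro Liminf_mono always_eventually allI)
    fix n
    have "B n \<subseteq> A n" by (auto simp: B_def)
    then show "ereal (prob (B n)) \<le> ereal (prob (A n))"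
      using A by (auto intro: finite_measure_mono)
  qed
  ultimately show ?thesis by (simp add: one_ereal_def)
qed

text \<open>
  A shift of the index changes the sum of the first \<open>n\<close> terms by a quantity bounded in \<open>n\<close>. This
  one fact yields both that the lower limits are tail measurable and that they are invariant under
  the skew product.
\<close>

lemma liminf_cesaro_shift:
  fixes u :: "nat \<Rightarrow> real"
  assumes bound: "\<And>j. \<bar>u j\<bar> \<le> B"
  shows "liminf (\<lambda>n. ereal (1 / real n * (\<Sum>j<n. u (j + m)))) =
         liminf (\<lambda>n. ereal (1 / real n * (\<Sum>j<n. u j)))"
proof -
  define d where "d n = 1 / real n * ((\<Sum>j<n. u j) - (\<Sum>j<n. u (j + m)))" for n
  have B0: "0 \<le> B" using bound[of 0] by linarith
  have sum_diff: "\<bar>(\<Sum>j<n. u j) - (\<Sum>j<n. u (j + m))\<bar> \<le> 2 * real m * B" for n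
  proof -
    have split: "(\<Sum>j<a + b. u j) = (\<Sum>j<a. u j) + (\<Sum>j<b. u (j + a))" for a b
      by (induction b) (simp_all add: add.commute)
    have "(\<Sum>j<n. u j) - (\<Sum>j<n. u (j + m)) = (\<Sum>j<m. u j) - (\<Sum>j<m. u (j + n))"
      using split[of n m] split[of m n] by (simp add: add.commute)
    moreover have "\<bar>\<Sum>j<m. u (j + k)\<bar> \<le> real m * B" for k
    proof -
      have "\<bar>\<Sum>j<m. u (j + k)\<bar> \<le> (\<Sum>j<m. \<bar>u (j + k)\<bar>)" by (rule sum_abs)
      also have "\<dots> \<le> real (card {..<m}) * B" by (rule sum_bounded_above) (rule bound)
      finally show ?thesis by simp
    qed
    from this[of 0] this[of n] have "\<bar>\<Sum>j<m. u j\<bar> \<le> real m * B" "\<bar>\<Sum>j<m. u (j + n)\<bar> \<le> real m * B"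
      by simp_all
    ultimately show ?thesis by linarith
  qed
  have "d \<longlonglongrightarrow> 0"
  proof (rule Lim_null_comparison)
    show "eventually (\<lambda>n. norm (d n) \<le> 2 * real m * B / real n) sequentially"
      using sum_diff by (auto simp: d_def abs_mult divide_right_mono)
    show "(\<lambda>n. 2 * real m * B / real n) \<longlonglongrightarrow> 0" by (rule lim_const_over_n)
  qed
  then have "(\<lambda>n. ereal (d n)) \<longlonglongrightarrow> ereal 0" by simp
  from ereal_liminf_lim_add[OF this, of "\<lambda>n. ereal (1 / real n * (\<Sum>j<n. u (j + m)))"]
  show ?thesis by (simp add: d_def algebra_simps zero_ereal_def[symmetric])
qed

lemma not_convergent_if_liminf_less_limsup:
  fixes u :: "nat \<Rightarrow> real"
  assumes "liminf (\<lambda>n. ereal (u n)) \<le> ereal a" "a < b" "ereal b \<le> limsup (\<lambda>n. ereal (u n))"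
  shows "\<not> convergent u"
proof
  assume "convergent u"
  then obtain L where "u \<longlonglongrightarrow> L" by (auto simp: convergent_def)
  then have "(\<lambda>n. ereal (u n)) \<longlonglongrightarrow> ereal L" by simp
  then have "liminf (\<lambda>n. ereal (u n)) = ereal L" "limsup (\<lambda>n. ereal (u n)) = ereal L"
    by (auto intro: lim_imp_Liminf lim_imp_Limsup)
  with assms show False by simp
qed

section \<open>Averages along random orbits\<close>

locale bernoulli_interval_maps =
  fixes p :: "'a pmf" and f :: "'a \<Rightarrow> real \<Rightarrow> real"
  assumes countable_alphabet: "countable (UNIV :: 'a set)"
    and pmf_positive: "\<And>a. pmf p a > 0"
    and fiber_measurable:
      "\<And>a. f a \<in> measurable (restrict_space borel {0..1}) (restrict_space borel {0..1})"
    and fiber_interior: "\<And>a x. x \<in> {0<..<1} \<Longrightarrow> f a x \<in> {0<..<1}"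
begin

sublocale sequence_space "measure_pmf p" ..

abbreviation P :: "(nat \<Rightarrow> 'a) measure" where
  "P \<equiv> bernoulli_measure p"

lemma prob_space_P: "prob_space P"
  unfolding bernoulli_measure_def by (rule P.prob_space_axioms)

lemma space_P [simp]: "space P = UNIV"
  by (simp add: bernoulli_measure_def space_PiM)

sublocale B: prob_space P
  by (rule prob_space_P)

lemma measurable_coordinate: "(\<lambda>\<omega>. \<omega> n) \<in> measurable P (count_space UNIV)"
  unfolding bernoulli_measure_def
  using measurable_component_singleton[of n UNIV "\<lambda>_. measure_pmf p"] by simp

text \<open>
  Evaluating the fiber map \<open>f (\<omega> n)\<close> is a measurable operation in the letter \<open>\<omega> n\<close> because there
  are only countably many letters. Joint measurability in the starting point is what Fubini needs
  in the end.
\<close>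

lemma measurable_fiber_iter_pair:
  "(\<lambda>(\<omega>, x). fiber_iter f \<omega> n x)
     \<in> measurable (P \<Otimes>\<^sub>M restrict_space borel {0..1}) (restrict_space borel {0..1})"
proof (induction n)
  case 0
  then show ?case by (simp add: measurable_snd[unfolded split_beta'] split_beta')
next
  case (Suc n)
  have "(\<lambda>q. f (fst q n) (fiber_iter f (fst q) n (snd q)))
      \<in> measurable (P \<Otimes>\<^sub>M restrict_space borel {0..1}) (restrict_space borel {0..1})"
  proof (rule measurable_compose_countable'[OF _ _ countable_alphabet])
    show "(\<lambda>q. f a (fiber_iter f (fst q) n (snd q)))
      \<in> measurable (P \<Otimes>\<^sub>M restrict_space borel {0..1}) (restrict_space borel {0..1})" for a
      using measurable_compose[OF Suc fiber_measurable[of a]] by (simp add: split_beta')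
    show "(\<lambda>q. fst q n) \<in> measurable (P \<Otimes>\<^sub>M restrict_space borel {0..1}) (count_space UNIV)"
      by (rule measurable_compose[OF measurable_fst measurable_coordinate])
  qed
  then show ?case by (simp add: split_beta')
qed

lemma borel_measurable_fiber_iter_pair:
  "(\<lambda>q. fiber_iter f (fst q) n (snd q)) \<in> borel_measurable (P \<Otimes>\<^sub>M restrict_space borel {0..1})"
  using measurable_fiber_iter_pair[of n] by (auto simp: measurable_restrict_space2_iff split_beta')

lemma borel_measurable_fiber_iter:
  assumes "x \<in> {0<..<1}"
  shows "(\<lambda>\<omega>. fiber_iter f \<omega> n x) \<in> borel_measurable P"
proof -
  have "(\<lambda>\<omega>. (\<omega>, x)) \<in> measurable P (P \<Otimes>\<^sub>M restrict_space borel {0..1})"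
    using assms by (intro measurable_Pair measurable_ident measurable_const)
      (auto simp: space_restrict_space)
  from measurable_compose[OF this borel_measurable_fiber_iter_pair[of n]] show ?thesis by simp
qed

lemma fiber_iter_interior:
  "x \<in> {0<..<1} \<Longrightarrow> fiber_iter f \<omega> n x \<in> {0<..<1}"
  by (induction n) (use fiber_interior in auto)

lemma borel_measurable_birkhoff_average [measurable]:
  assumes "x \<in> {0<..<1}" and [measurable]: "\<phi> \<in> borel_measurable borel"
  shows "(\<lambda>\<omega>. birkhoff_average f \<phi> \<omega> x n) \<in> borel_measurable P"
proof -
  note borel_measurable_fiber_iter[OF assms(1), measurable]
  show ?thesis unfolding birkhoff_average_def by measurable
qed

definition low_average_event :: "(real \<Rightarrow> real) \<Rightarrow> real \<Rightarrow> real \<Rightarrow> (nat \<Rightarrow> 'a) set" where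
  "low_average_event \<phi> c x = {\<omega>. liminf (\<lambda>n. ereal (birkhoff_average f \<phi> \<omega> x n)) \<le> ereal c}"

lemma low_average_event_measurable:
  assumes "x \<in> {0<..<1}" "\<phi> \<in> borel_measurable borel"
  shows "low_average_event \<phi> c x \<in> sets P"
proof -
  note borel_measurable_birkhoff_average[OF assms, measurable]
  have "{\<omega> \<in> space P. liminf (\<lambda>n. ereal (birkhoff_average f \<phi> \<omega> x n)) \<le> ereal c} \<in> sets P"
    by measurable
  then show ?thesis by (simp add: low_average_event_def)
qed

lemma liminf_birkhoff_average_delayed:
  assumes "x \<in> {0<..<1}" and "\<And>y. y \<in> {0<..<1} \<Longrightarrow> \<bar>\<phi> y\<bar> \<le> 1"
  shows "liminf (\<lambda>n. ereal (1 / real n * (\<Sum>j<n. \<phi> (fiber_iter f \<omega> (j + m) x)))) =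
         liminf (\<lambda>n. ereal (birkhoff_average f \<phi> \<omega> x n))"
  unfolding birkhoff_average_def
  using liminf_cesaro_shift[of "\<lambda>j. \<phi> (fiber_iter f \<omega> j x)" 1 m] assms fiber_iter_interior by auto

text \<open>
  By \<open>liminf_birkhoff_average_delayed\<close> the event is expressed by the positions at times later than
  any prescribed \<open>m\<close>.
\<close>

lemma low_average_event_tail:
  assumes x: "x \<in> {0<..<1}" and \<phi> [measurable]: "\<phi> \<in> borel_measurable borel"
    and bound: "\<And>y. y \<in> {0<..<1} \<Longrightarrow> \<bar>\<phi> y\<bar> \<le> 1"
  shows "low_average_event \<phi> c x \<in> tail_sigma_algebra P (\<lambda>n \<omega>. fiber_iter f \<omega> n x)"
proof -
  let ?A = "\<lambda>n. sets (vimage_algebra (space P) (\<lambda>\<omega>. fiber_iter f \<omega> (Suc n) x) borel)"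
  have "low_average_event \<phi> c x \<in> sigma_sets (space P) (\<Union> (?A ` {m..}))" for m
  proof -
    define N where "N = sigma (space P) (\<Union> (?A ` {m..}))"
    have sets_N: "sets N = sigma_sets (space P) (\<Union> (?A ` {m..}))"
      unfolding N_def by (rule sets_measure_of) auto
    have space_N: "space N = UNIV" by (simp add: N_def)
    have X [measurable]: "(\<lambda>\<omega>. fiber_iter f \<omega> (j + Suc m) x) \<in> borel_measurable N" for j
    proof (rule measurableI)
      fix S :: "real set" assume "S \<in> sets borel"
      then have "(\<lambda>\<omega>. fiber_iter f \<omega> (Suc (j + m)) x) -` S \<inter> space P \<in> ?A (j + m)"
        by (rule in_vimage_algebra)
      then show "(\<lambda>\<omega>. fiber_iter f \<omega> (j + Suc m) x) -` S \<inter> space N \<in> sets N"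
        unfolding sets_N space_N by (intro sigma_sets.Basic UN_I[of "j + m"]) auto
    qed simp
    have "{\<omega> \<in> space N. liminf (\<lambda>n. ereal (1 / real n *
            (\<Sum>j<n. \<phi> (fiber_iter f \<omega> (j + Suc m) x)))) \<le> ereal c} \<in> sets N"
      by measurable
    moreover have "{\<omega> \<in> space N. liminf (\<lambda>n. ereal (1 / real n *
            (\<Sum>j<n. \<phi> (fiber_iter f \<omega> (j + Suc m) x)))) \<le> ereal c} = low_average_event \<phi> c x"
      using liminf_birkhoff_average_delayed[where \<phi> = \<phi> and m = "Suc m", OF x bound]
      by (simp only: low_average_event_def space_N UNIV_I simp_thms)
    ultimately show ?thesis by (simp only: sets_N)
  qed
  then show ?thesis
    unfolding tail_sigma_algebra_def prob_space.tail_events_def[OF prob_space_P] by auto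
qed

text \<open>
  Prepending an independent letter to a Bernoulli sequence gives a Bernoulli sequence, so Fubini
  splits off the first letter. Almost all letters are all letters, since each has positive mass.
\<close>

lemma AE_first_letter:
  assumes E: "E \<in> sets P"
  shows "(AE \<omega> in P. \<omega> \<in> E) \<longleftrightarrow> (\<forall>a. AE \<omega> in P. case_nat a \<omega> \<in> E)"
proof -
  let ?h = "\<lambda>(a, \<omega>). case_nat a \<omega> :: nat \<Rightarrow> 'a"
  interpret pair_sigma_finite "measure_pmf p" P ..
  have distr: "distr (measure_pmf p \<Otimes>\<^sub>M P) P ?h = P"
    using PiM_iter by (simp add: bernoulli_measure_def)
  have h [measurable]: "?h \<in> measurable (measure_pmf p \<Otimes>\<^sub>M P) P"
    unfolding bernoulli_measure_def by measurable
  have E': "{\<omega> \<in> space P. \<omega> \<in> E} \<in> sets P" using E by simp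
  have "{q \<in> space (measure_pmf p \<Otimes>\<^sub>M P). ?h q \<in> E} \<in> sets (measure_pmf p \<Otimes>\<^sub>M P)"
    using measurable_sets[OF h E] by (simp add: vimage_def Int_def conj_commute)
  then have prod: "{q \<in> space (measure_pmf p \<Otimes>\<^sub>M P). case_nat (fst q) (snd q) \<in> E}
      \<in> sets (measure_pmf p \<Otimes>\<^sub>M P)" by (simp add: split_beta')
  have "(AE \<omega> in P. \<omega> \<in> E) \<longleftrightarrow> (AE q in measure_pmf p \<Otimes>\<^sub>M P. ?h q \<in> E)"
    by (subst distr[symmetric], subst AE_distr_iff[OF h E'], rule refl)
  also have "\<dots> \<longleftrightarrow> (AE a in measure_pmf p. AE \<omega> in P. case_nat a \<omega> \<in> E)"
    using AE_pair_iff[OF prod] by (simp add: split_beta')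
  also have "\<dots> \<longleftrightarrow> (\<forall>a. AE \<omega> in P. case_nat a \<omega> \<in> E)"
  proof -
    have "set_pmf p = UNIV" using pmf_positive by (auto simp: set_pmf_iff less_le)
    then show ?thesis by (simp add: AE_measure_pmf_iff)
  qed
  finally show ?thesis .
qed

lemma fiber_iter_case_nat:
  "fiber_iter f (case_nat a \<omega>) (Suc n) x = fiber_iter f \<omega> n (f a x)"
  by (induction n) simp_all

text \<open>
  The orbit of \<open>x\<close> under \<open>a \<omega>\<close> is, after one step, the orbit of \<open>f a x\<close> under \<open>\<omega>\<close>.
\<close>

lemma case_nat_in_low_average_event:
  assumes "x \<in> {0<..<1}" and "\<And>y. y \<in> {0<..<1} \<Longrightarrow> \<bar>\<phi> y\<bar> \<le> 1"
  shows "case_nat a \<omega> \<in> low_average_event \<phi> c x \<longleftrightarrow> \<omega> \<in> low_average_event \<phi> c (f a x)"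
  using liminf_birkhoff_average_delayed[where \<phi> = \<phi> and m = 1 and \<omega> = "case_nat a \<omega>", OF assms]
  by (simp add: low_average_event_def fiber_iter_case_nat birkhoff_average_def
        del: fiber_iter.simps)

text \<open>
  If \<open>d\<close> is the fraction of time spent in \<open>J\<close>, the average of \<open>\<phi>\<close> is at most
  \<open>c d + C (1 - d) = C - (C - c) d\<close>. So if the lower limit of the averages almost surely exceeded
  this value at \<open>d = \<alpha>\<close>, then almost surely the fraction of time would eventually be below \<open>\<alpha>\<close>,
  and the probability of this would tend to 1, against the fluctuation law.
\<close>

lemma not_AE_not_low_average:
  assumes z: "z \<in> {0<..<1}" and \<phi>: "\<phi> \<in> borel_measurable borel"
    and J: "J \<in> sets borel"
    and upper: "\<And>y. y \<in> {0<..<1} \<Longrightarrow> \<phi> y \<le> C"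
    and upper_J: "\<And>y. y \<in> {0<..<1} \<inter> J \<Longrightarrow> \<phi> y \<le> c"
    and "c \<le> C"
    and visits: "liminf (\<lambda>n. ereal (measure P
          {\<omega> \<in> space P. birkhoff_average f (indicator J) \<omega> z n \<le> \<alpha>})) < 1"
  shows "\<not> (AE \<omega> in P. \<omega> \<notin> low_average_event \<phi> (C - (C - c) * \<alpha>) z)"
proof
  assume none: "AE \<omega> in P. \<omega> \<notin> low_average_event \<phi> (C - (C - c) * \<alpha>) z"
  let ?A = "\<lambda>n. {\<omega> \<in> space P. birkhoff_average f (indicator J) \<omega> z n \<le> \<alpha>}"
  have ind: "indicator J \<in> borel_measurable borel" using J by simp
  have "1 \<le> liminf (\<lambda>n. ereal (measure P (?A n)))"
  proof (rule B.liminf_prob_ge_1)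
    show "?A n \<in> B.events" for n
      using borel_measurable_birkhoff_average[OF z ind, of n] by measurable
    show "AE \<omega> in P. eventually (\<lambda>n. \<omega> \<in> ?A n) sequentially"
      using none
    proof eventually_elim
      case (elim \<omega>)
      then have "ereal (C - (C - c) * \<alpha>) < liminf (\<lambda>n. ereal (birkhoff_average f \<phi> \<omega> z n))"
        by (simp add: low_average_event_def not_le)
      from less_LiminfD[OF this]
      have "eventually (\<lambda>n. C - (C - c) * \<alpha> < birkhoff_average f \<phi> \<omega> z n) sequentially" by simp
      then show ?case using eventually_gt_at_top[of 0]
      proof eventually_elim
        case (elim n)
        let ?d = "birkhoff_average f (indicator J) \<omega> z n"
        have "(\<Sum>j<n. \<phi> (fiber_iter f \<omega> j z))
            \<le> (\<Sum>j<n. C - (C - c) * indicator J (fiber_iter f \<omega> j z))"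
        proof (rule sum_mono)
          fix j
          show "\<phi> (fiber_iter f \<omega> j z) \<le> C - (C - c) * indicator J (fiber_iter f \<omega> j z)"
            using upper[of "fiber_iter f \<omega> j z"] upper_J[of "fiber_iter f \<omega> j z"]
              fiber_iter_interior[OF z, of \<omega> j] by (auto split: split_indicator)
        qed
        also have "\<dots> = real n * C - (C - c) * (\<Sum>j<n. indicator J (fiber_iter f \<omega> j z))"
          by (simp add: sum_subtractf sum_distrib_left)
        finally have "birkhoff_average f \<phi> \<omega> z n
            \<le> 1 / real n * (real n * C - (C - c) * (\<Sum>j<n. indicator J (fiber_iter f \<omega> j z)))"
          unfolding birkhoff_average_def by (rule mult_left_mono) simp
        also have "\<dots> = C - (C - c) * ?d"
          using elim(2) by (simp add: birkhoff_average_def field_simps)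
        finally have "(C - c) * ?d < (C - c) * \<alpha>" using elim(1) by linarith
        then have "?d < \<alpha>" using \<open>c \<le> C\<close> by (simp add: mult_less_cancel_left)
        then show ?case by simp
      qed
    qed
  qed
  with visits show False by simp
qed

end

section \<open>From one starting point to all\<close>

locale monotone_tail_trivial_maps = bernoulli_interval_maps p f
  for p :: "'a pmf" and f :: "'a \<Rightarrow> real \<Rightarrow> real" +
  assumes tail_trivial: "\<And>x A. x \<in> {0<..<1} \<Longrightarrow>
      A \<in> tail_sigma_algebra (bernoulli_measure p) (\<lambda>n \<omega>. fiber_iter f \<omega> n x) \<Longrightarrow>
      measure (bernoulli_measure p) A \<in> {0, 1}"
    and fiber_mono: "\<And>a. mono_on {0<..<1} (f a)"
    and moves_down: "\<And>x. x \<in> {0<..<1} \<Longrightarrow> \<exists>a. f a x < x"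
    and moves_up: "\<And>x. x \<in> {0<..<1} \<Longrightarrow> \<exists>a. x < f a x"
begin

lemma low_average_zero_one:
  assumes "x \<in> {0<..<1}" "\<phi> \<in> borel_measurable borel" "\<And>y. y \<in> {0<..<1} \<Longrightarrow> \<bar>\<phi> y\<bar> \<le> 1"
    and "\<not> (AE \<omega> in P. \<omega> \<notin> low_average_event \<phi> c x)"
  shows "AE \<omega> in P. \<omega> \<in> low_average_event \<phi> c x"
  using tail_trivial[OF assms(1) low_average_event_tail[OF assms(1-3), of c]] assms(4)
    B.prob_eq_0[OF low_average_event_measurable[OF assms(1,2)]]
    B.prob_eq_1[OF low_average_event_measurable[OF assms(1,2)]] by auto

lemma fiber_iter_mono:
  assumes "x \<in> {0<..<1}" "y \<in> {0<..<1}" "x \<le> y"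
  shows "fiber_iter f \<omega> n x \<le> fiber_iter f \<omega> n y"
proof (induction n)
  case (Suc n)
  then show ?case
    using mono_onD[OF fiber_mono] fiber_iter_interior assms(1,2) by simp
qed (simp add: assms(3))

text \<open>
  Consider the supremum \<open>s\<close> of a proper such set. If \<open>s\<close> belongs to the set, a fiber map that moves
  \<open>s\<close> up leads out of it; if not, a fiber map that moves \<open>s\<close> down leads into it. Only the behavior
  at the single point \<open>s\<close> matters, which is why jumps of the fiber maps do no harm.
\<close>

lemma invariant_lower_set_full:
  assumes L: "L \<subseteq> {0<..<1}" "z \<in> L"
    and lower: "\<And>x y. y \<in> L \<Longrightarrow> x \<in> {0<..<1} \<Longrightarrow> x \<le> y \<Longrightarrow> x \<in> L"
    and invariant: "\<And>a x. x \<in> {0<..<1} \<Longrightarrow> f a x \<in> L \<longleftrightarrow> x \<in> L"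
  shows "L = {0<..<1}"
proof (rule ccontr)
  assume "L \<noteq> {0<..<1}"
  then obtain y where y: "y \<in> {0<..<1}" "y \<notin> L" using L(1) by blast
  have below_y: "s \<le> y" if "s \<in> L" for s
    using lower[OF that y(1)] y(2) by linarith
  then have bdd: "bdd_above L" by (auto simp: bdd_above_def)
  have "z \<le> Sup L" using L bdd by (auto intro: cSup_upper)
  moreover have "Sup L \<le> y" using L below_y by (intro cSup_least) auto
  ultimately have sup: "Sup L \<in> {0<..<1}" using L y by auto
  show False
  proof (cases "Sup L \<in> L")
    case True
    obtain a where "Sup L < f a (Sup L)" using moves_up[OF sup] by auto
    moreover have "f a (Sup L) \<in> L" using True invariant[OF sup] by simp
    ultimately show False using cSup_upper[OF _ bdd] by fastforce
  next
    case False
    obtain a where a: "f a (Sup L) < Sup L" using moves_down[OF sup] by auto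
    then obtain s where "s \<in> L" "f a (Sup L) < s" using less_cSup_iff[OF _ bdd] L by auto
    then have "f a (Sup L) \<in> L" using lower[of s "f a (Sup L)"] fiber_interior[OF sup] by auto
    then show False using False invariant[OF sup] by simp
  qed
qed

text \<open>
  Invariance of the set \<open>G\<close> is an equivalence for every single letter, although \<open>AE_first_letter\<close>
  speaks of all letters at once: the backward direction applies that lemma to the complementary
  event, which the zero-one law makes almost sure as soon as \<open>x\<close> is not in \<open>G\<close>.
\<close>

lemma low_average_everywhere:
  assumes z: "z \<in> {0<..<1}" "AE \<omega> in P. \<omega> \<in> low_average_event \<phi> c z"
    and \<phi>: "\<phi> \<in> borel_measurable borel" "\<And>y. y \<in> {0<..<1} \<Longrightarrow> \<bar>\<phi> y\<bar> \<le> 1"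
    and monotone: "mono_on {0<..<1} \<phi> \<or> antimono_on {0<..<1} \<phi>"
    and x: "x \<in> {0<..<1}"
  shows "AE \<omega> in P. \<omega> \<in> low_average_event \<phi> c x"
proof -
  define G where "G = {x \<in> {0<..<1}. AE \<omega> in P. \<omega> \<in> low_average_event \<phi> c x}"
  have not_G: "AE \<omega> in P. \<omega> \<notin> low_average_event \<phi> c x" if "x \<in> {0<..<1} - G" for x
    using that low_average_zero_one[OF _ \<phi>, of x c] by (auto simp: G_def)
  have G_not_null: "\<not> (AE \<omega> in P. \<omega> \<notin> low_average_event \<phi> c x)" if "x \<in> G" for x
  proof
    assume "AE \<omega> in P. \<omega> \<notin> low_average_event \<phi> c x"
    moreover have "AE \<omega> in P. \<omega> \<in> low_average_event \<phi> c x" using that by (simp add: G_def)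
    ultimately have "AE \<omega> in P. False" by eventually_elim simp
    then show False by simp
  qed
  have invariant: "f a x \<in> G \<longleftrightarrow> x \<in> G" if x: "x \<in> {0<..<1}" for a x
  proof -
    have first: "case_nat a \<omega> \<in> low_average_event \<phi> c x
        \<longleftrightarrow> \<omega> \<in> low_average_event \<phi> c (f a x)" for \<omega>
      by (rule case_nat_in_low_average_event[OF x]) (rule \<phi>(2))
    show ?thesis
    proof
      assume "x \<in> G"
      then have "AE \<omega> in P. case_nat a \<omega> \<in> low_average_event \<phi> c x"
        using AE_first_letter[OF low_average_event_measurable[OF x \<phi>(1)]] by (simp add: G_def)
      then show "f a x \<in> G"
        using fiber_interior[OF x] by (simp add: G_def first)
    next
      assume fa: "f a x \<in> G"
      show "x \<in> G"
      proof (rule ccontr)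
        assume "x \<notin> G"
        then have "AE \<omega> in P. \<omega> \<in> - low_average_event \<phi> c x" using not_G x by simp
        moreover have "- low_average_event \<phi> c x \<in> sets P"
          using sets.compl_sets[OF low_average_event_measurable[OF x \<phi>(1)]]
          by (simp add: Compl_eq_Diff_UNIV)
        ultimately have "AE \<omega> in P. case_nat a \<omega> \<notin> low_average_event \<phi> c x"
          using AE_first_letter[of "- low_average_event \<phi> c x"] by simp
        then show False
          using G_not_null[OF fa] by (simp add: first)
      qed
    qed
  qed
  have transfer: "x \<in> G"
    if "y \<in> G" "x \<in> {0<..<1}" and le: "\<And>\<omega> j. \<phi> (fiber_iter f \<omega> j x) \<le> \<phi> (fiber_iter f \<omega> j y)"
    for x y
  proof -
    have "low_average_event \<phi> c y \<subseteq> low_average_event \<phi> c x"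
    proof
      fix \<omega> assume "\<omega> \<in> low_average_event \<phi> c y"
      moreover have "liminf (\<lambda>n. ereal (birkhoff_average f \<phi> \<omega> x n))
          \<le> liminf (\<lambda>n. ereal (birkhoff_average f \<phi> \<omega> y n))"
        by (intro Liminf_mono always_eventually allI)
           (auto simp: birkhoff_average_def intro!: divide_right_mono sum_mono le)
      ultimately show "\<omega> \<in> low_average_event \<phi> c x"
        unfolding low_average_event_def by auto
    qed
    moreover have "AE \<omega> in P. \<omega> \<in> low_average_event \<phi> c y" using that(1) by (simp add: G_def)
    ultimately have "AE \<omega> in P. \<omega> \<in> low_average_event \<phi> c x" by (auto elim: eventually_mono)
    then show ?thesis using that(2) by (simp add: G_def)
  qed
  have zG: "z \<in> G" using z by (simp add: G_def)
  have G_sub: "G \<subseteq> {0<..<1}" by (auto simp: G_def)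
  from monotone have "G = {0<..<1}"
  proof
    assume mono: "mono_on {0<..<1} \<phi>"
    have "x \<in> G" if "y \<in> G" "x \<in> {0<..<1}" "x \<le> y" for x y
    proof (rule transfer[OF that(1,2)])
      show "\<phi> (fiber_iter f \<omega> j x) \<le> \<phi> (fiber_iter f \<omega> j y)" for \<omega> j
        using that G_sub by (intro mono_onD[OF mono] fiber_iter_interior fiber_iter_mono) auto
    qed
    then show ?thesis using invariant by (intro invariant_lower_set_full[OF G_sub zG]) auto
  next
    assume antimono: "antimono_on {0<..<1} \<phi>"
    have upper: "x \<in> G" if "y \<in> G" "x \<in> {0<..<1}" "y \<le> x" for x y
    proof (rule transfer[OF that(1,2)])
      show "\<phi> (fiber_iter f \<omega> j x) \<le> \<phi> (fiber_iter f \<omega> j y)" for \<omega> j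
        using that G_sub
        by (intro monotone_onD[OF antimono] fiber_iter_interior fiber_iter_mono) auto
    qed
    show ?thesis
    proof (rule ccontr)
      assume "G \<noteq> {0<..<1}"
      \<comment> \<open>Here \<open>G\<close> is a final segment, so its complement is the initial segment to be excluded.\<close>
      then obtain w where w: "w \<in> {0<..<1} - G"
        using psubset_imp_ex_mem[of G "{0<..<1}"] G_sub by auto
      have "{0<..<1} - G = {0<..<1}"
      proof (rule invariant_lower_set_full[OF _ w])
        show "x \<in> {0<..<1} - G" if "y \<in> {0<..<1} - G" "x \<in> {0<..<1}" "x \<le> y" for x y
          using upper[of x y] that by blast
        show "f a x \<in> {0<..<1} - G \<longleftrightarrow> x \<in> {0<..<1} - G" if "x \<in> {0<..<1}" for a x
          using invariant[OF that, of a] fiber_interior[OF that, of a] that by blast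
      qed blast
      then have "z \<in> {0<..<1} - G" using z(1) by simp
      then show False using zG by simp
    qed
  qed
  then have "x \<in> G" using x by simp
  then show ?thesis by (simp add: G_def)
qed

text \<open>
  Each fraction \<open>\<alpha> < 1\<close> of time spent in \<open>J\<close> gives the level \<open>C - (C - c) \<alpha>\<close>, which holds first at
  \<open>z\<close> and then at every starting point. Countably many \<open>\<alpha>\<close> tending to 1 bring the level down to \<open>c\<close>.
\<close>

lemma liminf_average_le:
  assumes z: "z \<in> {0<..<1}" and J: "J \<in> sets borel"
    and visits: "\<And>\<alpha>. \<alpha> \<in> {0<..<1} \<Longrightarrow> liminf (\<lambda>n. ereal (measure P
          {\<omega> \<in> space P. birkhoff_average f (indicator J) \<omega> z n \<le> \<alpha>})) < 1"
    and \<phi>: "\<phi> \<in> borel_measurable borel" "\<And>y. y \<in> {0<..<1} \<Longrightarrow> \<bar>\<phi> y\<bar> \<le> 1"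
    and monotone: "mono_on {0<..<1} \<phi> \<or> antimono_on {0<..<1} \<phi>"
    and upper: "\<And>y. y \<in> {0<..<1} \<Longrightarrow> \<phi> y \<le> C"
    and upper_J: "\<And>y. y \<in> {0<..<1} \<inter> J \<Longrightarrow> \<phi> y \<le> c"
    and "c \<le> C"
    and x: "x \<in> {0<..<1}"
  shows "AE \<omega> in P. liminf (\<lambda>n. ereal (birkhoff_average f \<phi> \<omega> x n)) \<le> ereal c"
proof -
  define \<alpha> where "\<alpha> k = 1 - 1 / real (k + 2)" for k
  have \<alpha>: "\<alpha> k \<in> {0<..<1}" for k by (auto simp: \<alpha>_def field_simps)
  have \<alpha>_lim: "\<alpha> \<longlonglongrightarrow> 1"
    unfolding \<alpha>_def
    using tendsto_diff[OF tendsto_const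
        LIMSEQ_ignore_initial_segment[OF lim_const_over_n[of 1], of 2], of 1]
    by simp
  have "AE \<omega> in P. \<omega> \<in> low_average_event \<phi> (C - (C - c) * \<alpha> k) x" for k
    using not_AE_not_low_average[OF z \<phi>(1) J upper upper_J \<open>c \<le> C\<close> visits[OF \<alpha>]]
    by (intro low_average_everywhere[OF z low_average_zero_one[OF z \<phi>] \<phi> monotone x])
  then have "AE \<omega> in P. \<forall>k. \<omega> \<in> low_average_event \<phi> (C - (C - c) * \<alpha> k) x"
    by (simp add: AE_all_countable)
  then show ?thesis
  proof eventually_elim
    case (elim \<omega>)
    have "(\<lambda>k. C - (C - c) * \<alpha> k) \<longlonglongrightarrow> C - (C - c) * 1"
      by (intro tendsto_intros \<alpha>_lim)
    then have "(\<lambda>k. ereal (C - (C - c) * \<alpha> k)) \<longlonglongrightarrow> ereal c" by simp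
    moreover have "\<forall>k. liminf (\<lambda>n. ereal (birkhoff_average f \<phi> \<omega> x n)) \<le> ereal (C - (C - c) * \<alpha> k)"
      using elim by (simp add: low_average_event_def)
    ultimately show ?case by (intro LIMSEQ_le_const[of "\<lambda>k. ereal (C - (C - c) * \<alpha> k)"]) blast+
  qed
qed

lemma birkhoff_average_oscillates:
  assumes "pointwise_fiber_fluctuation_law p f \<gamma>0 \<gamma>1"
    and \<gamma>: "\<gamma>0 \<in> {0<..<1}" "\<gamma>1 \<in> {0<..<1}" and x: "x \<in> {0<..<1}"
  shows "AE \<omega> in P. liminf (\<lambda>n. ereal (birkhoff_average f (\<lambda>y. y) \<omega> x n)) \<le> ereal \<gamma>0 \<and>
           ereal \<gamma>1 \<le> limsup (\<lambda>n. ereal (birkhoff_average f (\<lambda>y. y) \<omega> x n))"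
proof -
  obtain x0 x1 where x01: "x0 \<in> {0<..<1}" "x1 \<in> {0<..<1}"
    and visits0: "\<And>\<alpha>. \<alpha> \<in> {0<..<1} \<Longrightarrow> liminf (\<lambda>n. ereal (measure P
          {\<omega> \<in> space P. birkhoff_average f (indicator {0..\<gamma>0}) \<omega> x0 n \<le> \<alpha>})) < 1"
    and visits1: "\<And>\<alpha>. \<alpha> \<in> {0<..<1} \<Longrightarrow> liminf (\<lambda>n. ereal (measure P
          {\<omega> \<in> space P. birkhoff_average f (indicator {\<gamma>1..1}) \<omega> x1 n \<le> \<alpha>})) < 1"
    using assms(1) unfolding pointwise_fiber_fluctuation_law_def by blast
  \<comment> \<open>The bounds \<open>1\<close> and \<open>0\<close> are the suprema of \<open>y\<close> and of \<open>-y\<close> on \<open>(0,1)\<close>.\<close>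
  have "AE \<omega> in P. liminf (\<lambda>n. ereal (birkhoff_average f (\<lambda>y. y) \<omega> x n)) \<le> ereal \<gamma>0"
    by (rule liminf_average_le[OF x01(1) _ visits0, where C = 1])
       (use \<gamma> x in \<open>auto intro!: mono_onI\<close>)
  moreover have "AE \<omega> in P. liminf (\<lambda>n. ereal (birkhoff_average f uminus \<omega> x n)) \<le> ereal (- \<gamma>1)"
    by (rule liminf_average_le[OF x01(2) _ visits1, where C = 0])
       (use \<gamma> x in \<open>auto intro!: monotone_onI\<close>)
  ultimately show ?thesis
  proof eventually_elim
    case (elim \<omega>)
    have "liminf (\<lambda>n. - ereal (birkhoff_average f (\<lambda>y. y) \<omega> x n)) \<le> - ereal \<gamma>1"
      using elim(2) by (simp add: birkhoff_average_def sum_negf)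
    then have "- limsup (\<lambda>n. ereal (birkhoff_average f (\<lambda>y. y) \<omega> x n)) \<le> - ereal \<gamma>1"
      by (simp only: ereal_Liminf_uminus)
    then have "ereal \<gamma>1 \<le> limsup (\<lambda>n. ereal (birkhoff_average f (\<lambda>y. y) \<omega> x n))"
      by (simp only: ereal_minus_le_minus)
    with elim(1) show ?case ..
  qed
qed

end

context bernoulli_interval_maps
begin

text \<open>
  The endpoints 0 and 1, about which the hypothesis is silent, form a Lebesgue null set. Joint
  measurability of the oscillation event lets Fubini combine the null sets of the individual
  starting points.
\<close>

lemma historical_behavior_ae_if_oscillates:
  assumes "a < b"
    and oscillates: "\<And>x. x \<in> {0<..<1} \<Longrightarrow> AE \<omega> in P.
           liminf (\<lambda>n. ereal (birkhoff_average f (\<lambda>y. y) \<omega> x n)) \<le> ereal a \<and>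
           ereal b \<le> limsup (\<lambda>n. ereal (birkhoff_average f (\<lambda>y. y) \<omega> x n))"
  shows "historical_behavior_ae p f"
proof -
  let ?L = "restrict_space lborel {0..1::real}"
  let ?Q = "\<lambda>\<omega> x. liminf (\<lambda>n. ereal (birkhoff_average f (\<lambda>y. y) \<omega> x n)) \<le> ereal a \<and>
           ereal b \<le> limsup (\<lambda>n. ereal (birkhoff_average f (\<lambda>y. y) \<omega> x n))"
  have "finite_measure ?L" by (intro finite_measureI) (simp add: emeasure_restrict_space)
  then interpret L: finite_measure ?L .
  interpret pair_sigma_finite P ?L ..
  have sets_eq: "sets (P \<Otimes>\<^sub>M ?L) = sets (P \<Otimes>\<^sub>M restrict_space borel {0..1})"
    by (intro sets_pair_measure_cong sets_restrict_space_cong) auto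
  have [measurable]: "(\<lambda>q. fiber_iter f (fst q) n (snd q)) \<in> borel_measurable (P \<Otimes>\<^sub>M ?L)" for n
    using borel_measurable_fiber_iter_pair[of n] measurable_cong_sets[OF sets_eq refl] by blast
  have meas: "{q \<in> space (P \<Otimes>\<^sub>M ?L). ?Q (fst q) (snd q)} \<in> sets (P \<Otimes>\<^sub>M ?L)"
    unfolding birkhoff_average_def by measurable
  have "AE x in ?L. AE \<omega> in P. ?Q \<omega> x"
  proof -
    have "AE x in lborel. x \<noteq> (0::real) \<and> x \<noteq> 1"
      using AE_lborel_singleton[of "0::real"] AE_lborel_singleton[of "1::real"] by eventually_elim simp
    then have "AE x in lborel. x \<in> {0..1} \<longrightarrow> (AE \<omega> in P. ?Q \<omega> x)"
      by eventually_elim (use oscillates in auto)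
    then show ?thesis
      by (subst AE_restrict_space_iff) (simp_all only: sets_lborel space_lborel Int_UNIV_right, simp)
  qed
  then have "AE \<omega> in P. AE x in ?L. ?Q \<omega> x" using AE_commute[OF meas] by blast
  then have "AE q in P \<Otimes>\<^sub>M ?L. ?Q (fst q) (snd q)" using AE_pair_iff[OF meas] by blast
  then show ?thesis
    unfolding historical_behavior_ae_def
  proof eventually_elim
    case (elim q)
    have "\<not> convergent (birkhoff_average f (\<lambda>y. y) (fst q) (snd q))"
      using elim \<open>a < b\<close> by (intro not_convergent_if_liminf_less_limsup) auto
    moreover have "continuous_on {0..1} (\<lambda>y::real. y)" by (rule continuous_on_id)
    ultimately show ?case unfolding split_beta by blast
  qed
qed

end

theorem theorem1:
  fixes p :: "'a pmf" and f :: "'a \<Rightarrow> real \<Rightarrow> real" and \<gamma>0 \<gamma>1 :: real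
  assumes "countable (UNIV :: 'a set)"
    and "\<forall>a. pmf p a > 0"
    and "\<forall>a. f a \<in> measurable (restrict_space borel {0..1}) (restrict_space borel {0..1})"
    and tail: "\<forall>x\<in>{0<..<1}.
           \<forall>A\<in>tail_sigma_algebra (bernoulli_measure p) (\<lambda>n \<omega>. fiber_iter f \<omega> n x).
             measure (bernoulli_measure p) A \<in> {0, 1}"
    and interior: "\<forall>\<omega>::nat \<Rightarrow> 'a. f (\<omega> 0) \<in> {0<..<1} \<rightarrow> {0<..<1} \<and>
           f (\<omega> 0) \<in> measurable (restrict_space borel {0<..<1}) (restrict_space borel {0<..<1}) \<and>
           mono_on {0<..<1} (f (\<omega> 0))"
    and updown: "\<forall>x\<in>{0<..<1}. \<exists>(\<alpha>::nat \<Rightarrow> 'a) (\<beta>::nat \<Rightarrow> 'a). f (\<alpha> 0) x < x \<and> x < f (\<beta> 0) x"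
    and "\<gamma>0 \<in> {0<..<1}" and "\<gamma>1 \<in> {0<..<1}" and "\<gamma>0 < \<gamma>1"
    and fluct: "pointwise_fiber_fluctuation_law p f \<gamma>0 \<gamma>1"
  shows "(\<forall>x\<in>{0<..<1}. AE \<omega> in bernoulli_measure p.
           liminf (\<lambda>n. ereal (birkhoff_average f (\<lambda>y. y) \<omega> x n)) \<le> ereal \<gamma>0 \<and>
           \<gamma>0 < \<gamma>1 \<and>
           ereal \<gamma>1 \<le> limsup (\<lambda>n. ereal (birkhoff_average f (\<lambda>y. y) \<omega> x n))) \<and>
         historical_behavior_ae p f"
proof -
  interpret monotone_tail_trivial_maps p f
  proof
    fix a :: 'a and x :: real
    show "countable (UNIV :: 'a set)" by fact
    show "pmf p a > 0" using assms(2) by simp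
    show "f a \<in> measurable (restrict_space borel {0..1}) (restrict_space borel {0..1})"
      using assms(3) by simp
    show "mono_on {0<..<1} (f a)" using interior[rule_format, of "\<lambda>_. a"] by simp
    show "f a x \<in> {0<..<1}" if "x \<in> {0<..<1}"
      using interior[rule_format, of "\<lambda>_. a"] that by blast
    show "\<exists>a. f a x < x" "\<exists>a. x < f a x" if "x \<in> {0<..<1}"
      using updown that by blast+
    show "measure (bernoulli_measure p) A \<in> {0, 1}"
      if "x \<in> {0<..<1}" "A \<in> tail_sigma_algebra (bernoulli_measure p) (\<lambda>n \<omega>. fiber_iter f \<omega> n x)" for A
      using tail that by blast
  qed
  have oscillates: "AE \<omega> in bernoulli_measure p.
           liminf (\<lambda>n. ereal (birkhoff_average f (\<lambda>y. y) \<omega> x n)) \<le> ereal \<gamma>0 \<and>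
           ereal \<gamma>1 \<le> limsup (\<lambda>n. ereal (birkhoff_average f (\<lambda>y. y) \<omega> x n))"
    if "x \<in> {0<..<1}" for x
    using birkhoff_average_oscillates[OF fluct \<open>\<gamma>0 \<in> {0<..<1}\<close> \<open>\<gamma>1 \<in> {0<..<1}\<close> that] .
  then show ?thesis
    using historical_behavior_ae_if_oscillates[OF \<open>\<gamma>0 < \<gamma>1\<close>] \<open>\<gamma>0 < \<gamma>1\<close> by simp
qed

end
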